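(* Let $\Gamma$ be a bridgeless metrized graph. Then $$\sum_{e_i\in E(\Gamma)}\frac{L_iK_i(\Gamma)}{L_i+R_i}=\sum_{e_i\in E(\Gamma)}\frac{L_iR_i}{(L_i+R_i)^2}\big(z(\overline{\Gamma}_i)-z(\Gamma-e_i)\big)=\sum_{e_i\in E(\Gamma)}\frac{L_i^2R_i}{(L_i+R_i)^2}.$$
   Context: A metrized graph is a finite connected graph (multiple edges and self-loops allowed) whose edges $e_j$ are identified with closed segments of lengths $L_j>0$; its vertex set is finite, nonempty, and contains all points of valence $\neq2$. For an edge $e_j$ of a metrized graph $G$, $G-e_j$ is $G$ with the interior of $e_j$ removed and $R_j(G)$ is the effective resistance between the endpoints of $e_j$ in $G-e_j$ (edges are resistors with resistance equal to length); if $G-e_j$ is disconnected, $R_j=\infty$ and $\frac{L_j^2}{L_j+R_j}:=0$. Write $R_j=R_j(\Gamma)$. $\Gamma$ is bridgeless if every $\Gamma-e_j$ is connected. $z(G)=\sum_{e_j\in E(G)}\frac{L_j^2}{L_j+R_j(G)}$. $\overline{\Gamma}_i$ is obtained from $\Gamma$ by contracting $e_i$ to a point. $K_i(\Gamma)=\sum_{e_j\in E(\Gamma),\,j\ne i}\frac{L_j^2}{L_j+R_j}-\sum_{e_j\in E(\Gamma-e_i)}\frac{L_j^2}{L_j+R_j(\Gamma-e_i)}$. *)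

theory Defs
  imports Complex_Main "Graph_Theory.Digraph_Component"
begin

text \<open>
  A metrized graph with a chosen vertex set is a finite connected multigraph together with
  positive edge lengths. The orientation carried by \<^typ>\<open>('a, 'b) pre_digraph\<close> is an
  arbitrary choice of a first and a second endpoint for each edge; \<^const>\<open>Digraph_Component.connected\<close>
  is connectedness of the underlying undirected graph and includes that the vertex set is nonempty.
  The points of valence different from 2 are vertices automatically, since interior points of
  edges have valence 2.
\<close>

locale metrized_graph = fin_digraph G for G :: "('a, 'b) pre_digraph" +
  fixes L :: "'b \<Rightarrow> real"
  assumes connected: "Digraph_Component.connected G"
    and length_pos: "e \<in> arcs G \<Longrightarrow> L e > 0"

abbreviation del_edge :: "('a, 'b) pre_digraph \<Rightarrow> 'b \<Rightarrow> ('a, 'b) pre_digraph" where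
  "del_edge G e \<equiv> pre_digraph.del_arc G e"

definition bridgeless :: "('a, 'b) pre_digraph \<Rightarrow> bool" where
  "bridgeless G \<longleftrightarrow> (\<forall>e\<in>arcs G. Digraph_Component.connected (del_edge G e))"

text \<open>
  The vertex \<open>head G e\<close> is merged into \<open>tail G e\<close>. Other edges joining the two become
  self-loops; contracting a self-loop just removes it.
\<close>

definition contract_edge :: "('a, 'b) pre_digraph \<Rightarrow> 'b \<Rightarrow> ('a, 'b) pre_digraph" where
  "contract_edge G e =
     (let \<pi> = (\<lambda>v. if v = head G e then tail G e else v)
      in \<lparr> verts = \<pi> ` verts G, arcs = arcs G - {e}, tail = \<pi> \<circ> tail G, head = \<pi> \<circ> head G \<rparr>)"

text \<open>
  \<open>\<phi>\<close> is the potential when a unit current enters the network at \<open>p\<close> and leaves it at \<open>q\<close>;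
  \<open>i e\<close> is the current flowing through \<open>e\<close> from its tail to its head. The two
  conjuncts are Ohm's law and Kirchhoff's node law.
\<close>

definition unit_current_potential ::
    "('a, 'b) pre_digraph \<Rightarrow> ('b \<Rightarrow> real) \<Rightarrow> 'a \<Rightarrow> 'a \<Rightarrow> ('a \<Rightarrow> real) \<Rightarrow> bool" where
  "unit_current_potential G L p q \<phi> \<longleftrightarrow>
     (\<exists>i :: 'b \<Rightarrow> real.
        (\<forall>e\<in>arcs G. \<phi> (tail G e) - \<phi> (head G e) = L e * i e) \<and>
        (\<forall>v\<in>verts G. (\<Sum>e\<in>out_arcs G v. i e) - (\<Sum>e\<in>in_arcs G v. i e) =
                       of_bool (v = p) - of_bool (v = q)))"

text \<open>Only meaningful if \<open>p\<close> and \<open>q\<close> lie in the same component of \<open>G\<close>.\<close>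

definition effective_resistance ::
    "('a, 'b) pre_digraph \<Rightarrow> ('b \<Rightarrow> real) \<Rightarrow> 'a \<Rightarrow> 'a \<Rightarrow> real" where
  "effective_resistance G L p q =
     (THE r. \<exists>\<phi>. unit_current_potential G L p q \<phi> \<and> r = \<phi> p - \<phi> q)"

text \<open>
  \<open>edge_res G L j\<close> represents the resistance only if \<open>del_edge G j\<close> is connected. For a bridge the
  resistance is infinite and enters only through the quotient \<open>edge_term\<close>, which is then 0.
\<close>

definition edge_res :: "('a, 'b) pre_digraph \<Rightarrow> ('b \<Rightarrow> real) \<Rightarrow> 'b \<Rightarrow> real" where
  "edge_res G L j = effective_resistance (del_edge G j) L (tail G j) (head G j)"

definition edge_term :: "('a, 'b) pre_digraph \<Rightarrow> ('b \<Rightarrow> real) \<Rightarrow> 'b \<Rightarrow> real" where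
  "edge_term G L j =
     (if Digraph_Component.connected (del_edge G j) then (L j)\<^sup>2 / (L j + edge_res G L j) else 0)"

definition z_sum :: "('a, 'b) pre_digraph \<Rightarrow> ('b \<Rightarrow> real) \<Rightarrow> real" where
  "z_sum G L = (\<Sum>j\<in>arcs G. edge_term G L j)"

definition K_diff :: "('a, 'b) pre_digraph \<Rightarrow> ('b \<Rightarrow> real) \<Rightarrow> 'b \<Rightarrow> real" where
  "K_diff G L i = (\<Sum>j\<in>arcs G - {i}. edge_term G L j)
           - (\<Sum>j\<in>arcs (del_edge G i). edge_term (del_edge G i) L j)"

end

theory Submission
  imports Defs
begin

text \<open>
  Let \<open>Y j\<close> be the current that flows through the edges when a unit current enters at the first
  endpoint of the edge \<open>j\<close> and leaves at the second one. Then \<open>Y j j = R\<^sub>j / (L\<^sub>j + R\<^sub>j)\<close>, so that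
  the term of \<open>j\<close> is \<open>L\<^sub>j (1 - Y j j)\<close>, and deleting or contracting an edge \<open>i\<close> changes \<open>Y j\<close> by a
  multiple of \<open>Y i\<close>. In this way all three summands are expressed through the numbers
  \<open>L\<^sub>j Y j i Y i j\<close>, and the second equality becomes \<open>\<Sum>i. Y j i Y i j = Y j j\<close>: the matrix \<open>Y\<close> is the
  orthogonal projection onto the cut space, with respect to the inner product weighted by the
  lengths.
\<close>

section \<open>Weighted least squares\<close>

lemma weighted_sum_squares_eq_0_iff:
  fixes L x :: "'b \<Rightarrow> real"
  assumes "finite A" and L: "\<And>a. a \<in> A \<Longrightarrow> L a > 0"
  shows "(\<Sum>a\<in>A. L a * (x a)\<^sup>2) = 0 \<longleftrightarrow> (\<forall>a\<in>A. x a = 0)"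
proof -
  have "(\<Sum>a\<in>A. L a * (x a)\<^sup>2) = 0 \<longleftrightarrow> (\<forall>a\<in>A. L a * (x a)\<^sup>2 = 0)"
    using assms by (intro sum_nonneg_eq_0_iff) (auto simp: less_imp_le)
  then show ?thesis using L by fastforce
qed

text \<open>Existence of the orthogonal projection of \<open>f\<close> onto the span of the
  \<open>g v\<close>, for the inner product weighted by \<open>L\<close>, by Gram-Schmidt: a new
  vector contributes only its component orthogonal to the earlier ones. The coefficients
  \<open>c\<close> later serve as a potential.\<close>

lemma ex_weighted_projection:
  fixes L :: "'b \<Rightarrow> real" and g :: "'a \<Rightarrow> 'b \<Rightarrow> real" and f :: "'b \<Rightarrow> real"
  assumes "finite V" "finite A" and L: "\<And>a. a \<in> A \<Longrightarrow> L a > 0"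
  shows "\<exists>c. \<forall>w\<in>V. (\<Sum>a\<in>A. L a * (f a - (\<Sum>v\<in>V. c v * g v a)) * g w a) = 0"
  using assms(1)
proof (induction V arbitrary: f rule: finite_induct)
  case empty
  show ?case by simp
next
  case (insert u V)
  define ip where "ip x y = (\<Sum>a\<in>A. L a * x a * y a)" for x y :: "'b \<Rightarrow> real"
  obtain c where c: "\<And>w. w \<in> V \<Longrightarrow> ip (\<lambda>a. f a - (\<Sum>v\<in>V. c v * g v a)) (g w) = 0"
    using insert.IH[of f] by (auto simp: ip_def)
  obtain d where d: "\<And>w. w \<in> V \<Longrightarrow> ip (\<lambda>a. g u a - (\<Sum>v\<in>V. d v * g v a)) (g w) = 0"
    using insert.IH[of "g u"] by (auto simp: ip_def)
  define f' where "f' = (\<lambda>a. f a - (\<Sum>v\<in>V. c v * g v a))"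
  define g' where "g' = (\<lambda>a. g u a - (\<Sum>v\<in>V. d v * g v a))"
  \<comment> \<open>Coefficient of \<open>f'\<close> along \<open>g'\<close>. If
    \<open>ip g' g' = 0\<close>, then \<open>g'\<close> vanishes on \<open>A\<close>, and the value
    0 of the division does no harm.\<close>
  define s where "s = ip f' g' / ip g' g'"
  define r where "r = (\<lambda>a. f' a - s * g' a)"
  define k where "k = (\<lambda>v. if v = u then s else c v - s * d v)"
  have r_ip: "ip r y = ip f' y - s * ip g' y" for y
    unfolding ip_def r_def by (simp add: algebra_simps sum_subtractf sum_distrib_left)
  have r_old: "ip r (g w) = 0" if "w \<in> V" for w
    using c[OF that] d[OF that] by (simp add: r_ip f'_def g'_def)
  have "ip r g' = 0"
  proof (cases "ip g' g' = 0")
    case True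
    then have "\<forall>a\<in>A. g' a = 0"
      using weighted_sum_squares_eq_0_iff[OF assms(2) L, where x = g']
      by (simp add: ip_def power2_eq_square mult.assoc)
    then have "ip f' g' = 0" by (simp add: ip_def)
    then show ?thesis using True by (simp add: r_ip)
  qed (simp add: r_ip s_def)
  moreover have "ip r (g u) = ip r g' + (\<Sum>v\<in>V. d v * ip r (g v))"
  proof -
    have "(\<Sum>v\<in>V. d v * ip r (g v)) = ip r (\<lambda>a. \<Sum>v\<in>V. d v * g v a)"
      unfolding ip_def sum_distrib_left by (subst sum.swap) (simp add: mult_ac)
    then show ?thesis
      by (simp add: ip_def g'_def algebra_simps sum_subtractf)
  qed
  ultimately have "ip r (g u) = 0"
    using r_old by simp
  then have "\<forall>w\<in>insert u V. ip r (g w) = 0"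
    using r_old by auto
  moreover have "r a = f a - (\<Sum>v\<in>insert u V. k v * g v a)" for a
  proof -
    have "(\<Sum>v\<in>V. k v * g v a) = (\<Sum>v\<in>V. (c v - s * d v) * g v a)"
      using insert.hyps by (intro sum.cong) (auto simp: k_def)
    then show ?thesis
      using insert.hyps
      by (simp add: r_def f'_def g'_def k_def algebra_simps sum_subtractf sum_distrib_left)
  qed
  ultimately show ?case unfolding ip_def by auto
qed

section \<open>Connectedness through test functions\<close>

text \<open>A function that is equal across every edge is constant along walks. Conversely, the
  indicator of the component of a vertex is such a function, so its constancy makes the component
  everything. In this form connectedness can be read off from potentials.\<close>

lemma (in wf_digraph) connected_iff_potentials_constant:
  "Digraph_Component.connected G \<longleftrightarrow> verts G \<noteq> {} \<and>
    (\<forall>\<psi> :: 'a \<Rightarrow> real. (\<forall>a\<in>arcs G. \<psi> (tail G a) = \<psi> (head G a)) \<longrightarrow>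
       (\<forall>u\<in>verts G. \<forall>v\<in>verts G. \<psi> u = \<psi> v))" (is "?C \<longleftrightarrow> _ \<and> ?P")
proof -
  let ?R = "rtrancl_on (verts G) ((arcs_ends G)\<^sup>s)"
  have sym_mem: "(x, y) \<in> (arcs_ends G)\<^sup>s \<longleftrightarrow>
      (\<exists>a\<in>arcs G. x = tail G a \<and> y = head G a \<or> x = head G a \<and> y = tail G a)" for x y
    by (auto simp: symcl_def arcs_ends_conv image_iff)
  have "?P \<longleftrightarrow> (\<forall>u\<in>verts G. \<forall>v\<in>verts G. (u, v) \<in> ?R)"
  proof (intro iffI ballI allI impI)
    fix u v assume P: ?P and uv: "u \<in> verts G" "v \<in> verts G"
    let ?\<psi> = "\<lambda>x. of_bool ((u, x) \<in> ?R) :: real"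
    have "(u, tail G a) \<in> ?R \<longleftrightarrow> (u, head G a) \<in> ?R" if "a \<in> arcs G" for a
    proof -
      have "(tail G a, head G a) \<in> (arcs_ends G)\<^sup>s" "(head G a, tail G a) \<in> (arcs_ends G)\<^sup>s"
        using that sym_mem by blast+
      then show ?thesis
        using that by (meson rtrancl_on_into_rtrancl_on head_in_verts tail_in_verts)
    qed
    then have "?\<psi> u = ?\<psi> v" using spec[OF P, of ?\<psi>] uv by simp
    then show "(u, v) \<in> ?R" using uv by auto
  next
    fix \<psi> :: "'a \<Rightarrow> real" and u v
    assume R: "\<forall>u\<in>verts G. \<forall>v\<in>verts G. (u, v) \<in> ?R"
      and \<psi>: "\<forall>a\<in>arcs G. \<psi> (tail G a) = \<psi> (head G a)" and "u \<in> verts G" "v \<in> verts G"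
    then have "(u, v) \<in> ?R" by blast
    then show "\<psi> u = \<psi> v"
      by induction (use \<psi> in \<open>auto simp: sym_mem\<close>)
  qed
  then show ?thesis by (auto simp: connected_conv)
qed

section \<open>Unit currents and effective resistance\<close>

text \<open>
  Kirchhoff's node law is kept in a weak form, tested against all functions on the vertices. Deleting
  an edge drops one summand, and contracting one amounts to restricting the test functions to
  those that agree at its two endpoints.
\<close>

definition unit_current ::
    "('a, 'b) pre_digraph \<Rightarrow> ('b \<Rightarrow> real) \<Rightarrow> 'a \<Rightarrow> 'a \<Rightarrow> ('a \<Rightarrow> real) \<Rightarrow> ('b \<Rightarrow> real) \<Rightarrow> bool" where
  "unit_current G L p q \<phi> y \<longleftrightarrow>
     (\<forall>a\<in>arcs G. \<phi> (tail G a) - \<phi> (head G a) = L a * y a) \<and>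
     (\<forall>\<psi> :: 'a \<Rightarrow> real.
        (\<Sum>a\<in>arcs G. y a * (\<psi> (tail G a) - \<psi> (head G a))) = \<psi> p - \<psi> q)"

lemma sum_mult_of_bool_diff:
  fixes \<psi> :: "'a \<Rightarrow> real"
  assumes "finite V" "p \<in> V" "q \<in> V"
  shows "(\<Sum>v\<in>V. \<psi> v * (of_bool (v = p) - of_bool (v = q))) = \<psi> p - \<psi> q"
proof -
  have "(\<Sum>v\<in>V. \<psi> v * of_bool (v = r)) = \<psi> r" if "r \<in> V" for r
    using assms(1) that by (simp add: of_bool_def if_distrib cong: if_cong)
  then show ?thesis
    using assms by (simp add: right_diff_distrib sum_subtractf)
qed

text \<open>Summation by parts: each edge contributes at its tail and, negatively, at its
  head.\<close>

lemma (in fin_digraph) sum_node_law: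
  fixes \<psi> :: "'a \<Rightarrow> real"
  shows "(\<Sum>v\<in>verts G. \<psi> v * ((\<Sum>a\<in>out_arcs G v. y a) - (\<Sum>a\<in>in_arcs G v. y a))) =
    (\<Sum>a\<in>arcs G. y a * (\<psi> (tail G a) - \<psi> (head G a)))"
proof -
  have "(\<Sum>v\<in>verts G. \<psi> v * (\<Sum>a\<in>{a \<in> arcs G. t a = v}. y a)) = (\<Sum>a\<in>arcs G. \<psi> (t a) * y a)"
    if "t ` arcs G \<subseteq> verts G" for t
    by (subst sum.group[OF finite_arcs finite_verts that, symmetric]) (simp add: sum_distrib_left)
  from this[of "tail G"] this[of "head G"] show ?thesis
    by (simp add: out_arcs_def in_arcs_def image_subset_iff algebra_simps sum_subtractf)
qed

text \<open>Summation by parts turns the node law at all vertices into the weak form; the indicator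
  of a single vertex as test function recovers the law there.\<close>

lemma (in fin_digraph) unit_current_potential_iff:
  assumes "p \<in> verts G" "q \<in> verts G"
  shows "unit_current_potential G L p q \<phi> \<longleftrightarrow> (\<exists>y. unit_current G L p q \<phi> y)"
proof -
  have "(\<forall>v\<in>verts G. (\<Sum>a\<in>out_arcs G v. y a) - (\<Sum>a\<in>in_arcs G v. y a) =
          of_bool (v = p) - of_bool (v = q)) \<longleftrightarrow>
        (\<forall>\<psi> :: 'a \<Rightarrow> real.
          (\<Sum>a\<in>arcs G. y a * (\<psi> (tail G a) - \<psi> (head G a))) = \<psi> p - \<psi> q)"
    (is "?N \<longleftrightarrow> ?W") for y
  proof
    assume ?N
    then have "(\<Sum>v\<in>verts G. \<psi> v * ((\<Sum>a\<in>out_arcs G v. y a) - (\<Sum>a\<in>in_arcs G v. y a))) =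
        (\<Sum>v\<in>verts G. \<psi> v * (of_bool (v = p) - of_bool (v = q)))" for \<psi> :: "'a \<Rightarrow> real"
      by (intro sum.cong) auto
    then show ?W
      using assms by (simp only: sum_node_law sum_mult_of_bool_diff finite_verts) blast
  next
    assume W: ?W
    show ?N
    proof
      fix v assume v: "v \<in> verts G"
      have "(\<Sum>a\<in>out_arcs G v. y a) - (\<Sum>a\<in>in_arcs G v. y a) =
          (\<Sum>w\<in>verts G. of_bool (w = v) * ((\<Sum>a\<in>out_arcs G w. y a) - (\<Sum>a\<in>in_arcs G w. y a)))"
        using v by (simp add: of_bool_def if_distrib if_distribR cong: if_cong)
      also have "\<dots> = of_bool (v = p) - of_bool (v = q)"
        unfolding sum_node_law by (subst W[rule_format]) (auto simp: of_bool_def)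
      finally show "(\<Sum>a\<in>out_arcs G v. y a) - (\<Sum>a\<in>in_arcs G v. y a) =
          of_bool (v = p) - of_bool (v = q)" .
    qed
  qed
  then show ?thesis
    unfolding unit_current_potential_def unit_current_def by auto
qed

text \<open>The potential \<open>\<phi>'\<close> serves as test function in the node law of
  \<open>x\<close>. The left side is symmetric in the two currents, which yields reciprocity; for
  \<open>x = y\<close> it is the dissipated energy.\<close>

lemma unit_current_pairing:
  assumes "unit_current G L p q \<phi> x" "unit_current G L p' q' \<phi>' y"
  shows "(\<Sum>a\<in>arcs G. L a * x a * y a) = \<phi>' p - \<phi>' q"
proof -
  have "(\<Sum>a\<in>arcs G. L a * x a * y a) =
      (\<Sum>a\<in>arcs G. x a * (\<phi>' (tail G a) - \<phi>' (head G a)))"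
    using assms(2) by (intro sum.cong) (auto simp: unit_current_def)
  then show ?thesis
    using assms(1) by (simp add: unit_current_def)
qed

text \<open>Two potentials for the same source and sink may differ, but by the symmetry of the
  pairing their drops from \<open>p\<close> to \<open>q\<close> agree. This gives the uniqueness
  that \<open>THE\<close> requires.\<close>

lemma (in fin_digraph) effective_resistance_eq:
  assumes pq: "p \<in> verts G" "q \<in> verts G" and y: "unit_current G L p q \<phi> y"
  shows "effective_resistance G L p q = \<phi> p - \<phi> q"
  unfolding effective_resistance_def unit_current_potential_iff[OF pq]
proof (rule the_equality)
  show "\<exists>\<phi>'. (\<exists>y. unit_current G L p q \<phi>' y) \<and> \<phi> p - \<phi> q = \<phi>' p - \<phi>' q"
    using y by blast
next
  fix r assume "\<exists>\<phi>'. (\<exists>y. unit_current G L p q \<phi>' y) \<and> r = \<phi>' p - \<phi>' q"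
  then obtain \<phi>' y' where y': "unit_current G L p q \<phi>' y'" and r: "r = \<phi>' p - \<phi>' q"
    by blast
  show "r = \<phi> p - \<phi> q"
    using unit_current_pairing[OF y y'] unit_current_pairing[OF y' y] r by (simp add: mult_ac)
qed

section \<open>Deletion and contraction of an edge\<close>

lemma fin_digraph_contract_edge:
  assumes "fin_digraph G" and e: "e \<in> arcs G"
  shows "fin_digraph (contract_edge G e)"
proof -
  interpret fin_digraph G by fact
  show ?thesis 
    by unfold_locales (use e in \<open>auto simp: contract_edge_def Let_def image_iff\<close>)
qed

text \<open>Superposition: dropping \<open>i\<close> loses the current \<open>x i\<close> between
  its ends, and \<open>c\<close> copies of what \<open>y\<close> carries outside \<open>i\<close>
  replace it. The condition \<open>y i \<noteq> 1\<close> says that this remainder has nonzero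
  strength.\<close>

lemma unit_current_del_edge:
  fixes G :: "('a, 'b) pre_digraph"
  assumes fin: "finite (arcs G)" and i: "i \<in> arcs G"
    and x: "unit_current G L p q \<phi> x"
    and y: "unit_current G L (tail G i) (head G i) \<theta> y" and yi: "y i \<noteq> 1"
  defines "c \<equiv> x i / (1 - y i)"
  shows "unit_current (del_edge G i) L p q (\<lambda>v. \<phi> v + c * \<theta> v) (\<lambda>a. x a + c * y a)"
  unfolding unit_current_def pre_digraph.del_arc_simps
proof (intro conjI ballI allI)
  fix a assume "a \<in> arcs G - {i}"
  then have "\<phi> (tail G a) - \<phi> (head G a) = L a * x a" "\<theta> (tail G a) - \<theta> (head G a) = L a * y a"
    using x y by (auto simp: unit_current_def)
  then show "\<phi> (tail G a) + c * \<theta> (tail G a) - (\<phi> (head G a) + c * \<theta> (head G a)) = L a * (x a + c * y a)"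
    by algebra
next
  fix \<psi> :: "'a \<Rightarrow> real"
  let ?d = "\<lambda>a. \<psi> (tail G a) - \<psi> (head G a)"
  \<comment> \<open>Source and sink of \<open>y\<close> are the ends of \<open>i\<close>, so outside
    \<open>i\<close> it has strength \<open>1 - y i\<close> between them.\<close>
  have "(\<Sum>a\<in>arcs G - {i}. x a * ?d a) = (\<psi> p - \<psi> q) - x i * ?d i"
    and "(\<Sum>a\<in>arcs G - {i}. y a * ?d a) = (1 - y i) * ?d i"
    using x y by (simp_all add: unit_current_def sum_diff1 fin i left_diff_distrib)
  moreover have "(\<Sum>a\<in>arcs G - {i}. (x a + c * y a) * ?d a) =
      (\<Sum>a\<in>arcs G - {i}. x a * ?d a) + c * (\<Sum>a\<in>arcs G - {i}. y a * ?d a)"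
    by (simp add: distrib_right sum.distrib sum_distrib_left mult.assoc)
  ultimately show "(\<Sum>a\<in>arcs G - {i}. (x a + c * y a) * ?d a) = \<psi> p - \<psi> q"
    using yi by (simp add: c_def)
qed

text \<open>The choice of \<open>c\<close> leaves no current through \<open>i\<close>. By Ohm's law
  the corrected potential then agrees at the two ends of \<open>i\<close> and descends to the
  quotient; there source and sink of \<open>y\<close> coincide, so only those of \<open>x\<close>
  remain.\<close>

lemma unit_current_contract_edge:
  fixes G :: "('a, 'b) pre_digraph"
  assumes fin: "finite (arcs G)" and i: "i \<in> arcs G"
    and x: "unit_current G L p q \<phi> x"
    and y: "unit_current G L (tail G i) (head G i) \<theta> y" and yi: "y i \<noteq> 0"
  defines "c \<equiv> x i / y i" and "\<pi> \<equiv> \<lambda>v. if v = head G i then tail G i else v"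
  shows "unit_current (contract_edge G i) L (\<pi> p) (\<pi> q) (\<lambda>v. \<phi> v - c * \<theta> v) (\<lambda>a. x a - c * y a)"
proof -
  have ohm: "\<phi> (tail G a) - \<phi> (head G a) = L a * x a" "\<theta> (tail G a) - \<theta> (head G a) = L a * y a"
    if "a \<in> arcs G" for a
    using x y that by (auto simp: unit_current_def)
  have "x i - c * y i = 0" using yi by (simp add: c_def)
  then have "\<phi> (tail G i) - c * \<theta> (tail G i) = \<phi> (head G i) - c * \<theta> (head G i)"
    using ohm[OF i] by algebra
  then have \<pi>: "\<phi> (\<pi> v) - c * \<theta> (\<pi> v) = \<phi> v - c * \<theta> v" for v
    by (simp add: \<pi>_def)
  have proj: "tail (contract_edge G i) = \<pi> \<circ> tail G" "head (contract_edge G i) = \<pi> \<circ> head G"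
    "arcs (contract_edge G i) = arcs G - {i}"
    by (auto simp: contract_edge_def Let_def \<pi>_def)
  show ?thesis
    unfolding unit_current_def proj o_apply \<pi>
  proof (intro conjI ballI allI)
    fix a assume "a \<in> arcs G - {i}"
    then have "\<phi> (tail G a) - \<phi> (head G a) = L a * x a" "\<theta> (tail G a) - \<theta> (head G a) = L a * y a"
      using ohm by auto
    then show "\<phi> (tail G a) - c * \<theta> (tail G a) - (\<phi> (head G a) - c * \<theta> (head G a)) =
        L a * (x a - c * y a)"
      by algebra
  next
    fix \<psi> :: "'a \<Rightarrow> real"
    \<comment> \<open>Test functions on the quotient are pulled back along \<open>\<pi>\<close>;
      they do not change across \<open>i\<close>, so the summand of \<open>i\<close> is 0.\<close>
    let ?d = "\<lambda>a. \<psi> (\<pi> (tail G a)) - \<psi> (\<pi> (head G a))"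
    have di: "?d i = 0" by (simp add: \<pi>_def)
    have "(\<Sum>a\<in>arcs G. x a * ?d a) = \<psi> (\<pi> p) - \<psi> (\<pi> q)"
      using x unfolding unit_current_def by (auto dest: spec[of _ "\<psi> \<circ> \<pi>"])
    moreover have "(\<Sum>a\<in>arcs G. y a * ?d a) = 0"
      using y di unfolding unit_current_def by (auto dest: spec[of _ "\<psi> \<circ> \<pi>"])
    moreover have "(\<Sum>a\<in>arcs G - {i}. (x a - c * y a) * ?d a) =
        (\<Sum>a\<in>arcs G. x a * ?d a) - c * (\<Sum>a\<in>arcs G. y a * ?d a)"
      using di by (simp add: sum.remove[OF fin i] left_diff_distrib sum_subtractf
          sum_distrib_left mult.assoc)
    ultimately show "(\<Sum>a\<in>arcs G - {i}. (x a - c * y a) * ?d a) = \<psi> (\<pi> p) - \<psi> (\<pi> q)"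
      by simp
  qed
qed

section \<open>The current belonging to an edge of a metrized graph\<close>

context metrized_graph
begin

lemma metrized_graph_del_edge:
  assumes "Digraph_Component.connected (del_edge G i)"
  shows "metrized_graph (del_edge G i) L"
  using assms length_pos
  by (auto simp: metrized_graph_def metrized_graph_axioms_def fin_digraph_del_arc)

text \<open>A function on the quotient pulls back to one on the vertices of \<open>G\<close> that
  agrees across \<open>i\<close>, so connectedness carries over.\<close>

lemma metrized_graph_contract_edge:
  assumes i: "i \<in> arcs G"
  shows "metrized_graph (contract_edge G i) L"
proof -
  interpret C: fin_digraph "contract_edge G i"
    using fin_digraph i by (rule fin_digraph_contract_edge)
  let ?\<pi> = "\<lambda>v. if v = head G i then tail G i else v"
  have "Digraph_Component.connected (contract_edge G i)"
    unfolding C.connected_iff_potentials_constant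
  proof (intro conjI allI impI)
    show "verts (contract_edge G i) \<noteq> {}"
      using connected by (auto simp: contract_edge_def Let_def connected_iff_potentials_constant)
  next
    fix \<psi> :: "'a \<Rightarrow> real"
    assume \<psi>: "\<forall>a\<in>arcs (contract_edge G i). \<psi> (tail (contract_edge G i) a) = \<psi> (head (contract_edge G i) a)"
    have "(\<psi> \<circ> ?\<pi>) (tail G a) = (\<psi> \<circ> ?\<pi>) (head G a)" if "a \<in> arcs G" for a
    proof (cases "a = i")
      case False
      then show ?thesis using \<psi> that by (auto simp: contract_edge_def Let_def)
    qed simp
    then have "\<forall>u\<in>verts G. \<forall>v\<in>verts G. (\<psi> \<circ> ?\<pi>) u = (\<psi> \<circ> ?\<pi>) v"
      using connected unfolding connected_iff_potentials_constant by blast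
    then show "\<forall>u\<in>verts (contract_edge G i). \<forall>v\<in>verts (contract_edge G i). \<psi> u = \<psi> v"
      unfolding contract_edge_def Let_def pre_digraph.select_convs o_apply by blast
  qed
  then show ?thesis
    using length_pos C.fin_digraph
    by (auto simp: metrized_graph_def metrized_graph_axioms_def contract_edge_def Let_def)
qed

text \<open>The current is the orthogonal projection of the indicator of \<open>j\<close> onto the
  cut space; the normal equations are the node law.\<close>

lemma ex_edge_current:
  assumes j: "j \<in> arcs G"
  shows "\<exists>\<phi> y. unit_current G L (tail G j) (head G j) \<phi> y"
proof -
  \<comment> \<open>\<open>g v\<close> is the current that Ohm's law assigns to the indicator of
    \<open>v\<close> as potential; these currents span the cut space.\<close>
  define g :: "'a \<Rightarrow> 'b \<Rightarrow> real"
    where "g v a = (of_bool (v = tail G a) - of_bool (v = head G a)) / L a" for v a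
  obtain \<phi> where \<phi>: "(\<Sum>a\<in>arcs G. L a * (of_bool (a = j) - (\<Sum>v\<in>verts G. \<phi> v * g v a)) * g w a) = 0"
    if "w \<in> verts G" for w
    using ex_weighted_projection[OF finite_verts finite_arcs,
        where L = L and f = "\<lambda>a. of_bool (a = j)" and g = g] length_pos
    by auto
  define y where "y a = (\<Sum>v\<in>verts G. \<phi> v * g v a)" for a
  have sum_g: "(\<Sum>v\<in>verts G. \<psi> v * g v a) = (\<psi> (tail G a) - \<psi> (head G a)) / L a"
    if "a \<in> arcs G" for \<psi> a
    using that sum_mult_of_bool_diff[of "verts G" "tail G a" "head G a" \<psi>]
    by (simp add: g_def sum_divide_distrib[symmetric])
  have "unit_current G L (tail G j) (head G j) \<phi> y"
    unfolding unit_current_def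
  proof (intro conjI ballI allI)
    fix a assume a: "a \<in> arcs G"
    show "\<phi> (tail G a) - \<phi> (head G a) = L a * y a"
      using length_pos[OF a] by (simp add: y_def sum_g[OF a])
  next
    fix \<psi> :: "'a \<Rightarrow> real"
    let ?d = "\<lambda>a. \<psi> (tail G a) - \<psi> (head G a)"
    \<comment> \<open>The normal equations are combined with the coefficients
      \<open>\<psi> w\<close>; the weight \<open>L a\<close> cancels the denominator in
      \<open>g\<close>.\<close>
    have "0 = (\<Sum>w\<in>verts G. \<psi> w * (\<Sum>a\<in>arcs G. L a * (of_bool (a = j) - y a) * g w a))"
      using \<phi> by (simp add: y_def)
    also have "\<dots> = (\<Sum>a\<in>arcs G. L a * (of_bool (a = j) - y a) * (\<Sum>w\<in>verts G. \<psi> w * g w a))"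
      unfolding sum_distrib_left by (subst sum.swap) (simp add: mult_ac)
    also have "\<dots> = (\<Sum>a\<in>arcs G. (of_bool (a = j) - y a) * ?d a)"
      by (intro sum.cong refl) (use length_pos in \<open>force simp: sum_g\<close>)
    also have "\<dots> = ?d j - (\<Sum>a\<in>arcs G. y a * ?d a)"
    proof -
      have "(\<Sum>a\<in>arcs G. of_bool (a = j) * ?d a) = ?d j"
        using j by (simp add: of_bool_def if_distrib if_distribR cong: if_cong)
      then show ?thesis by (simp only: left_diff_distrib[of "of_bool _"] sum_subtractf)
    qed
    finally show "(\<Sum>a\<in>arcs G. y a * ?d a) = ?d j" by simp
  qed
  then show ?thesis by blast
qed

lemma edge_current_energy:
  assumes j: "j \<in> arcs G" and y: "unit_current G L (tail G j) (head G j) \<phi> y"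
  shows "(\<Sum>a\<in>arcs G. L a * (y a)\<^sup>2) = L j * y j"
  using unit_current_pairing[OF y y] y j by (simp add: unit_current_def power2_eq_square mult.assoc)

text \<open>If \<open>y j = 0\<close>, the energy \<open>L j * y j\<close> vanishes and with it the
  whole current; the indicator of \<open>tail G j\<close> as test function then shows that source
  and sink coincide. This singles out the self-loops, for which contraction is treated
  apart.\<close>

lemma edge_current_eq_0_iff:
  assumes j: "j \<in> arcs G" and y: "unit_current G L (tail G j) (head G j) \<phi> y"
  shows "y j = 0 \<longleftrightarrow> tail G j = head G j"
proof
  assume "tail G j = head G j"
  moreover have "\<phi> (tail G j) - \<phi> (head G j) = L j * y j" using y j by (simp add: unit_current_def)
  ultimately show "y j = 0" using length_pos[OF j] by simp
next
  assume "y j = 0"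
  then have "(\<Sum>a\<in>arcs G. L a * (y a)\<^sup>2) = 0" using edge_current_energy[OF j y] by simp
  then have "\<forall>a\<in>arcs G. y a = 0"
    using weighted_sum_squares_eq_0_iff[OF finite_arcs length_pos] by simp
  moreover have "(\<Sum>a\<in>arcs G. y a * (of_bool (tail G a = tail G j) - of_bool (head G a = tail G j))) =
      of_bool (tail G j = tail G j) - of_bool (head G j = tail G j)"
    using y by (auto simp: unit_current_def dest: spec[of _ "\<lambda>v. of_bool (v = tail G j)"])
  ultimately show "tail G j = head G j" by (simp split: if_splits)
qed

text \<open>If \<open>y j = 1\<close>, the edge \<open>j\<close> alone uses up the energy
  \<open>L j\<close>, so no current flows elsewhere and the potential is constant across all other
  edges but not across \<open>j\<close>. Conversely, a function witnessing disconnection must jump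
  across \<open>j\<close>, and as test function it leaves only the summand of
  \<open>j\<close>.\<close>

lemma edge_current_eq_1_iff:
  assumes j: "j \<in> arcs G" and y: "unit_current G L (tail G j) (head G j) \<phi> y"
  shows "y j = 1 \<longleftrightarrow> \<not> Digraph_Component.connected (del_edge G j)"
proof -
  interpret D: fin_digraph "del_edge G j" by (rule fin_digraph_del_arc)
  have ne: "verts G \<noteq> {}" using connected by (simp add: connected_iff_potentials_constant)
  have ohm: "\<phi> (tail G a) - \<phi> (head G a) = L a * y a" if "a \<in> arcs G" for a
    using y that by (simp add: unit_current_def)
  show ?thesis
  proof
    assume y1: "y j = 1"
    have "(\<Sum>a\<in>arcs G - {j}. L a * (y a)\<^sup>2) = 0"
      using edge_current_energy[OF j y] y1 by (simp add: sum.remove[OF finite_arcs j])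
    then have "\<forall>a\<in>arcs G - {j}. y a = 0"
      using weighted_sum_squares_eq_0_iff[of "arcs G - {j}" L y] length_pos by simp
    then have "\<forall>a\<in>arcs G - {j}. \<phi> (tail G a) = \<phi> (head G a)"
      using ohm by (metis DiffD1 eq_iff_diff_eq_0 mult_zero_right)
    moreover have "\<phi> (tail G j) \<noteq> \<phi> (head G j)" using ohm[OF j] y1 length_pos[OF j] by auto
    ultimately show "\<not> Digraph_Component.connected (del_edge G j)"
      using tail_in_verts[OF j] head_in_verts[OF j]
      unfolding D.connected_iff_potentials_constant del_arc_simps by meson
  next
    assume "\<not> Digraph_Component.connected (del_edge G j)"
    then obtain \<psi> :: "'a \<Rightarrow> real" where \<psi>: "\<forall>a\<in>arcs G - {j}. \<psi> (tail G a) = \<psi> (head G a)"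
      and "\<not> (\<forall>u\<in>verts G. \<forall>v\<in>verts G. \<psi> u = \<psi> v)"
      using ne by (auto simp: D.connected_iff_potentials_constant)
    then have "\<not> (\<forall>a\<in>arcs G. \<psi> (tail G a) = \<psi> (head G a))"
      using connected unfolding connected_iff_potentials_constant by blast
    then have "\<psi> (tail G j) \<noteq> \<psi> (head G j)" using \<psi> by blast
    moreover have "(\<Sum>a\<in>arcs G. y a * (\<psi> (tail G a) - \<psi> (head G a))) = \<psi> (tail G j) - \<psi> (head G j)"
      using y by (simp add: unit_current_def)
    then have "y j * (\<psi> (tail G j) - \<psi> (head G j)) = \<psi> (tail G j) - \<psi> (head G j)"
      using \<psi> by (simp add: sum.remove[OF finite_arcs j])
    ultimately show "y j = 1" by simp
  qed
qed

text \<open>Deletion is applied with \<open>x = y\<close>, which scales the potential by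
  \<open>1 + y j / (1 - y j) = 1 / (1 - y j)\<close>.\<close>

lemma edge_res_eq:
  assumes j: "j \<in> arcs G" and y: "unit_current G L (tail G j) (head G j) \<phi> y"
    and "Digraph_Component.connected (del_edge G j)"
  shows "edge_res G L j = L j * y j / (1 - y j)"
proof -
  interpret D: fin_digraph "del_edge G j" by (rule fin_digraph_del_arc)
  have y1: "y j \<noteq> 1" using assms edge_current_eq_1_iff by blast
  have "edge_res G L j = (1 + y j / (1 - y j)) * (\<phi> (tail G j) - \<phi> (head G j))"
    unfolding edge_res_def
    using D.effective_resistance_eq[OF _ _ unit_current_del_edge[OF finite_arcs j y y y1]] j
    by (simp add: algebra_simps)
  also have "\<phi> (tail G j) - \<phi> (head G j) = L j * y j" using y j by (simp add: unit_current_def)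
  finally show ?thesis using y1 by (simp add: field_simps)
qed

text \<open>For a bridge \<open>y j = 1\<close>, so the formula also yields the conventional value
  0. This matters because deleting an edge may create bridges.\<close>

lemma edge_term_eq:
  assumes j: "j \<in> arcs G" and y: "unit_current G L (tail G j) (head G j) \<phi> y"
  shows "edge_term G L j = L j * (1 - y j)"
proof (cases "Digraph_Component.connected (del_edge G j)")
  case True
  then have "1 - y j \<noteq> 0" using edge_current_eq_1_iff[OF j y] by simp
  then have "L j + edge_res G L j = L j / (1 - y j)"
    unfolding edge_res_eq[OF j y True] by (simp add: field_simps)
  then show ?thesis
    using True length_pos[OF j] by (simp add: edge_term_def power2_eq_square)
next
  case False
  then show ?thesis using edge_current_eq_1_iff[OF j y] by (simp add: edge_term_def)
qed

end

section \<open>Evaluation of the sums through the matrix of edge currents\<close>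

theorem theorem4p9:
  fixes \<Gamma> :: "('a, 'b) pre_digraph" and L :: "'b \<Rightarrow> real"
  assumes "metrized_graph \<Gamma> L" and "bridgeless \<Gamma>"
  shows "(\<Sum>i\<in>arcs \<Gamma>. L i * K_diff \<Gamma> L i / (L i + edge_res \<Gamma> L i)) =
           (\<Sum>i\<in>arcs \<Gamma>. L i * edge_res \<Gamma> L i / (L i + edge_res \<Gamma> L i)\<^sup>2 *
              (z_sum (contract_edge \<Gamma> i) L - z_sum (del_edge \<Gamma> i) L)) \<and>
         (\<Sum>i\<in>arcs \<Gamma>. L i * edge_res \<Gamma> L i / (L i + edge_res \<Gamma> L i)\<^sup>2 *
              (z_sum (contract_edge \<Gamma> i) L - z_sum (del_edge \<Gamma> i) L)) =
           (\<Sum>i\<in>arcs \<Gamma>. (L i)\<^sup>2 * edge_res \<Gamma> L i / (L i + edge_res \<Gamma> L i)\<^sup>2)"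
proof -
  interpret metrized_graph \<Gamma> L by fact
  have conn: "Digraph_Component.connected (del_edge \<Gamma> i)" if "i \<in> arcs \<Gamma>" for i
    using assms(2) that by (simp add: bridgeless_def)
  obtain \<Phi> Y where Y: "unit_current \<Gamma> L (tail \<Gamma> j) (head \<Gamma> j) (\<Phi> j) (Y j)"
    if "j \<in> arcs \<Gamma>" for j
    using ex_edge_current by metis
  have Y1: "Y i i \<noteq> 1" if "i \<in> arcs \<Gamma>" for i
    using edge_current_eq_1_iff[OF that Y[OF that]] conn[OF that] by simp
  have reciprocity: "L k * Y j k = L j * Y k j" if "j \<in> arcs \<Gamma>" "k \<in> arcs \<Gamma>" for j k
    using unit_current_pairing[OF Y[OF that(1)] Y[OF that(2)]]
      unit_current_pairing[OF Y[OF that(2)] Y[OF that(1)]] Y[OF that(1)] Y[OF that(2)] that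
    by (simp add: unit_current_def mult_ac)
  have projection: "(\<Sum>i\<in>arcs \<Gamma>. Y j i * Y i j) = Y j j" if j: "j \<in> arcs \<Gamma>" for j
  proof -
    \<comment> \<open>Reciprocity turns the sum into the energy of \<open>Y j\<close>.\<close>
    have "L j * (\<Sum>i\<in>arcs \<Gamma>. Y j i * Y i j) = (\<Sum>i\<in>arcs \<Gamma>. L i * (Y j i)\<^sup>2)"
      unfolding sum_distrib_left
    proof (intro sum.cong refl)
      fix i assume "i \<in> arcs \<Gamma>"
      from reciprocity[OF j this] show "L j * (Y j i * Y i j) = L i * (Y j i)\<^sup>2"
        by algebra
    qed
    then show ?thesis
      using edge_current_energy[OF j Y[OF j]] length_pos[OF j] by simp
  qed
  \<comment> \<open>The common value of the \<open>i\<close>-th summands of the first two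
    sums.\<close>
  define S where "S i = (\<Sum>j\<in>arcs \<Gamma> - {i}. L j * (Y j i * Y i j))" for i
  have del: "edge_term (del_edge \<Gamma> i) L j = L j * (1 - Y j j) - L j * (Y j i * Y i j) / (1 - Y i i)"
    if i: "i \<in> arcs \<Gamma>" and j: "j \<in> arcs \<Gamma> - {i}" for i j
  proof -
    interpret D: metrized_graph "del_edge \<Gamma> i" L
      using conn[OF i] by (rule metrized_graph_del_edge)
    from j have "j \<in> arcs \<Gamma>" by simp
    \<comment> \<open>After deletion the current of \<open>j\<close> through itself is
      \<open>Y j j + Y j i * Y i j / (1 - Y i i)\<close>.\<close>
    from D.edge_term_eq[of j, unfolded del_arc_simps, OF _ unit_current_del_edge[OF finite_arcs i Y[OF this] Y[OF i] Y1[OF i]]]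
    show ?thesis using j by (simp add: algebra_simps)
  qed
  have res: "edge_res \<Gamma> L i = L i * Y i i / (1 - Y i i)" if "i \<in> arcs \<Gamma>" for i
    using edge_res_eq[OF that Y[OF that] conn[OF that]] .
  have sum_res: "L i + edge_res \<Gamma> L i = L i / (1 - Y i i)" if "i \<in> arcs \<Gamma>" for i
    using Y1[OF that] by (simp add: res[OF that] field_simps)
  have K: "K_diff \<Gamma> L i = S i / (1 - Y i i)" if i: "i \<in> arcs \<Gamma>" for i
  proof -
    have "K_diff \<Gamma> L i = (\<Sum>j\<in>arcs \<Gamma> - {i}. edge_term \<Gamma> L j - edge_term (del_edge \<Gamma> i) L j)"
      by (simp add: K_diff_def sum_subtractf)
    also have "\<dots> = (\<Sum>j\<in>arcs \<Gamma> - {i}. L j * (Y j i * Y i j) / (1 - Y i i))"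
      by (intro sum.cong refl) (use edge_term_eq[OF _ Y] del[OF i] in auto)
    finally show ?thesis by (simp add: S_def sum_divide_distrib)
  qed
  have z: "z_sum (contract_edge \<Gamma> i) L - z_sum (del_edge \<Gamma> i) L = S i / (Y i i * (1 - Y i i))"
    if i: "i \<in> arcs \<Gamma>" and Y0: "Y i i \<noteq> 0" for i
  proof -
    interpret C: metrized_graph "contract_edge \<Gamma> i" L
      using i by (rule metrized_graph_contract_edge)
    have arcs_C: "arcs (contract_edge \<Gamma> i) = arcs \<Gamma> - {i}"
      by (simp add: contract_edge_def Let_def)
    \<comment> \<open>After contraction the current of \<open>j\<close> through itself is
      \<open>Y j j - Y j i * Y i j / Y i i\<close>.\<close>
    have con: "edge_term (contract_edge \<Gamma> i) L j = L j * (1 - Y j j) + L j * (Y j i * Y i j) / Y i i"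
      if j: "j \<in> arcs \<Gamma> - {i}" for j
    proof -
      from j have "j \<in> arcs \<Gamma>" by simp
      from unit_current_contract_edge[OF finite_arcs i Y[OF this] Y[OF i] Y0]
      have "unit_current (contract_edge \<Gamma> i) L (tail (contract_edge \<Gamma> i) j)
          (head (contract_edge \<Gamma> i) j) (\<lambda>v. \<Phi> j v - Y j i / Y i i * \<Phi> i v)
          (\<lambda>a. Y j a - Y j i / Y i i * Y i a)"
        by (simp add: contract_edge_def Let_def)
      from C.edge_term_eq[OF _ this] show ?thesis using j by (simp add: arcs_C algebra_simps)
    qed
    have "z_sum (contract_edge \<Gamma> i) L - z_sum (del_edge \<Gamma> i) L =
        (\<Sum>j\<in>arcs \<Gamma> - {i}. edge_term (contract_edge \<Gamma> i) L j - edge_term (del_edge \<Gamma> i) L j)"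
      by (simp add: z_sum_def arcs_C sum_subtractf)
    also have "\<dots> = (\<Sum>j\<in>arcs \<Gamma> - {i}. L j * (Y j i * Y i j) / (Y i i * (1 - Y i i)))"
    proof (intro sum.cong refl)
      fix j assume j: "j \<in> arcs \<Gamma> - {i}"
      have "1 / Y i i + 1 / (1 - Y i i) = 1 / (Y i i * (1 - Y i i))"
        using Y0 Y1[OF i] by (simp add: field_simps)
      then have "u / Y i i + u / (1 - Y i i) = u / (Y i i * (1 - Y i i))" for u
        by (metis (no_types) distrib_left mult.right_neutral times_divide_eq_right)
      then show "edge_term (contract_edge \<Gamma> i) L j - edge_term (del_edge \<Gamma> i) L j =
          L j * (Y j i * Y i j) / (Y i i * (1 - Y i i))"
        using con[OF j] del[OF i j] by simp
    qed
    finally show ?thesis by (simp add: S_def sum_divide_distrib)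
  qed
  have first: "L i * K_diff \<Gamma> L i / (L i + edge_res \<Gamma> L i) = S i" if i: "i \<in> arcs \<Gamma>" for i
    using length_pos[OF i] Y1[OF i] unfolding K[OF i] sum_res[OF i] by simp
  have coeff: "L i * edge_res \<Gamma> L i / (L i + edge_res \<Gamma> L i)\<^sup>2 = Y i i * (1 - Y i i)"
    if i: "i \<in> arcs \<Gamma>" for i
    using length_pos[OF i] Y1[OF i] unfolding sum_res[OF i] unfolding res[OF i]
    by (simp add: power2_eq_square)
  have second: "L i * edge_res \<Gamma> L i / (L i + edge_res \<Gamma> L i)\<^sup>2 *
      (z_sum (contract_edge \<Gamma> i) L - z_sum (del_edge \<Gamma> i) L) = S i" if i: "i \<in> arcs \<Gamma>" for i
  proof (cases "Y i i = 0")
    case True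
    then have "tail \<Gamma> i = head \<Gamma> i" using edge_current_eq_0_iff[OF i Y[OF i]] by simp
    \<comment> \<open>The ends of \<open>i\<close> coincide, so Ohm's law forces every current
      through \<open>i\<close> to vanish, and both sides are 0.\<close>
    then have "Y j i = 0" if "j \<in> arcs \<Gamma>" for j
      using Y[OF that] i length_pos[OF i] by (auto simp: unit_current_def)
    then have "S i = 0" by (simp add: S_def)
    then show ?thesis using True by (simp add: coeff[OF i])
  next
    case False
    then show ?thesis using Y1[OF i] by (simp add: coeff[OF i] z[OF i])
  qed
  \<comment> \<open>Adding the diagonal terms completes the double sum, which after the swap
    collapses by \<open>projection\<close> to the sum of \<open>L j * Y j j\<close>.\<close>
  have "(\<Sum>i\<in>arcs \<Gamma>. S i) = (\<Sum>i\<in>arcs \<Gamma>. (\<Sum>j\<in>arcs \<Gamma>. L j * (Y j i * Y i j)) - L i * (Y i i)\<^sup>2)"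
    by (intro sum.cong refl) (simp add: S_def sum.remove[OF finite_arcs] power2_eq_square)
  also have "\<dots> = (\<Sum>j\<in>arcs \<Gamma>. L j * (\<Sum>i\<in>arcs \<Gamma>. Y j i * Y i j)) - (\<Sum>i\<in>arcs \<Gamma>. L i * (Y i i)\<^sup>2)"
    unfolding sum_subtractf sum_distrib_left by (subst sum.swap) simp
  also have "\<dots> = (\<Sum>i\<in>arcs \<Gamma>. L i * (Y i i * (1 - Y i i)))"
    unfolding sum_subtractf[symmetric]
    by (intro sum.cong refl) (simp add: projection algebra_simps power2_eq_square)
  also have "\<dots> = (\<Sum>i\<in>arcs \<Gamma>. (L i)\<^sup>2 * edge_res \<Gamma> L i / (L i + edge_res \<Gamma> L i)\<^sup>2)"
    by (intro sum.cong refl) (simp add: coeff[symmetric] power2_eq_square)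
  finally show ?thesis using first second by simp
qed

end
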